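(* The number of queries required to decide the existence of a connected strongly-proportional allocation for $n$ hungry agents with equal entitlements, or to compute such an allocation if it exists, is in $\Theta(n^2)$.
   Context: The cake is $C=[0,1]$, to be divided among agents $[n]$. Each agent $i$ has a valuation function $V_i$ on the algebra generated by intervals of $C$ that is non-negative, finitely additive, normalized ($V_i(C)=1$), with $x\mapsto V_i([0,x])$ continuous. Agent $i$ is hungry if $V_i(X)>0$ for every interval $X$ of positive length. Equal entitlements means each agent has entitlement $w_i=1/n$. An allocation is a partition $C=X_1\sqcup\cdots\sqcup X_n$ into finite unions of closed intervals, pairwise disjoint except possibly at endpoints; it is connected if each $X_i$ is a single interval and strongly-proportional if $V_i(X_i)>w_i$ for all $i$. Algorithms access valuations only via queries (each counts as one): $\textsc{Eval}_i(x,y)=V_i([x,y])$; $\textsc{Mark}_i(x,r)$ returns the largest $z\in C$ with $V_i([x,z])=r$, or $\infty$ if $V_i([x,1])<r$. *)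

theory Defs
  imports "HOL-Analysis.Analysis" "HOL-Library.Landau_Symbols"
begin

definition cake :: "real set" where
  "cake = {0..1}"

definition cake_algebra :: "real set set" where
  "cake_algebra = algebra cake hull {I. is_interval I \<and> I \<subseteq> cake}"

text \<open>
  Continuity of \<open>x \<mapsto> V [0, x]\<close> on the cake excludes atoms everywhere except at the left
  endpoint; the condition \<open>V {0} = 0\<close> excludes the remaining one.
\<close>

definition valuation :: "(real set \<Rightarrow> real) \<Rightarrow> bool" where
  "valuation V \<longleftrightarrow>
     (\<forall>X\<in>cake_algebra. 0 \<le> V X) \<and>
     Measure_Space.additive cake_algebra V \<and>
     V cake = 1 \<and>
     continuous_on cake (\<lambda>x. V {0..x}) \<and>
     V {0} = 0"

definition hungry :: "(real set \<Rightarrow> real) \<Rightarrow> bool" where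
  "hungry V \<longleftrightarrow> (\<forall>X. is_interval X \<and> X \<subseteq> cake \<and> 0 < measure lborel X \<longrightarrow> 0 < V X)"

text \<open>
  Agents are the numbers \<open>1, \<dots>, n\<close>. Profiles of valuations, allocations and entitlements are
  functions on \<^typ>\<open>nat\<close> of which only the values on \<open>{1..n}\<close> matter.
\<close>

definition hungry_profiles :: "nat \<Rightarrow> (nat \<Rightarrow> real set \<Rightarrow> real) set" where
  "hungry_profiles n = {V. \<forall>i\<in>{1..n}. valuation (V i) \<and> hungry (V i)}"

definition closed_interval :: "real set \<Rightarrow> bool" where
  "closed_interval I \<longleftrightarrow> (\<exists>a b. a \<le> b \<and> I = {a..b})"

definition allocation :: "nat \<Rightarrow> (nat \<Rightarrow> real set) \<Rightarrow> bool" where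
  "allocation n X \<longleftrightarrow>
     (\<forall>i\<in>{1..n}. \<exists>\<I>. finite \<I> \<and> (\<forall>I\<in>\<I>. closed_interval I) \<and> X i = \<Union>\<I>) \<and>
     (\<Union>i\<in>{1..n}. X i) = cake \<and>
     (\<forall>i\<in>{1..n}. \<forall>j\<in>{1..n}. i \<noteq> j \<longrightarrow> X i \<inter> X j \<subseteq> frontier (X i) \<inter> frontier (X j))"

definition connected_allocation :: "nat \<Rightarrow> (nat \<Rightarrow> real set) \<Rightarrow> bool" where
  "connected_allocation n X \<longleftrightarrow> allocation n X \<and> (\<forall>i\<in>{1..n}. closed_interval (X i))"

definition strongly_proportional ::
  "nat \<Rightarrow> (nat \<Rightarrow> real) \<Rightarrow> (nat \<Rightarrow> real set \<Rightarrow> real) \<Rightarrow> (nat \<Rightarrow> real set) \<Rightarrow> bool" where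
  "strongly_proportional n w V X \<longleftrightarrow> (\<forall>i\<in>{1..n}. V i (X i) > w i)"

definition equal_entitlements :: "nat \<Rightarrow> nat \<Rightarrow> real" where
  "equal_entitlements n = (\<lambda>i. 1 / real n)"

definition connected_sp_allocation ::
  "nat \<Rightarrow> (nat \<Rightarrow> real set \<Rightarrow> real) \<Rightarrow> (nat \<Rightarrow> real set) \<Rightarrow> bool" where
  "connected_sp_allocation n V X \<longleftrightarrow>
     connected_allocation n X \<and> strongly_proportional n (equal_entitlements n) V X"

definition eval_query :: "(real set \<Rightarrow> real) \<Rightarrow> real \<Rightarrow> real \<Rightarrow> real" where
  "eval_query V x y = V {x..y}"

definition mark_query :: "(real set \<Rightarrow> real) \<Rightarrow> real \<Rightarrow> real \<Rightarrow> ereal" where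
  "mark_query V x r =
     (if V {x..1} < r then \<infinity> else ereal (GREATEST z. z \<in> cake \<and> V {x..z} = r))"

text \<open>
  A deterministic adaptive algorithm is a decision tree: an inner node asks agent \<open>i\<close> one query
  and continues with the subtree selected by the answer; a leaf stops with an output. Computation
  between queries is free and unrestricted.
\<close>

datatype 'o algorithm =
    Output 'o
  | Eval nat real real "real \<Rightarrow> 'o algorithm"
  | Mark nat real real "ereal \<Rightarrow> 'o algorithm"

primrec legal :: "nat \<Rightarrow> 'o algorithm \<Rightarrow> bool" where
  "legal n (Output out) \<longleftrightarrow> True"
| "legal n (Eval i x y k) \<longleftrightarrow>
     i \<in> {1..n} \<and> x \<in> cake \<and> y \<in> cake \<and> x \<le> y \<and> (\<forall>a. legal n (k a))"
| "legal n (Mark i x r k) \<longleftrightarrow>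
     i \<in> {1..n} \<and> x \<in> cake \<and> 0 \<le> r \<and> (\<forall>a. legal n (k a))"

primrec run :: "(nat \<Rightarrow> real set \<Rightarrow> real) \<Rightarrow> 'o algorithm \<Rightarrow> 'o" where
  "run V (Output out) = out"
| "run V (Eval i x y k) = run V (k (eval_query (V i) x y))"
| "run V (Mark i x r k) = run V (k (mark_query (V i) x r))"

primrec query_count :: "(nat \<Rightarrow> real set \<Rightarrow> real) \<Rightarrow> 'o algorithm \<Rightarrow> nat" where
  "query_count V (Output out) = 0"
| "query_count V (Eval i x y k) = Suc (query_count V (k (eval_query (V i) x y)))"
| "query_count V (Mark i x r k) = Suc (query_count V (k (mark_query (V i) x r)))"

definition solves ::
  "(nat \<Rightarrow> real set \<Rightarrow> real) set \<Rightarrow> ((nat \<Rightarrow> real set \<Rightarrow> real) \<Rightarrow> 'o \<Rightarrow> bool) \<Rightarrow> 'o algorithm \<Rightarrow> bool"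
  where "solves \<V> ok A \<longleftrightarrow> (\<forall>V\<in>\<V>. ok V (run V A))"

text \<open>
  Worst-case query complexity of the task of producing, on every profile \<open>V\<close> in \<open>\<V>\<close>, an output
  \<open>out\<close> with \<open>ok V out\<close>. It is \<open>\<infinity>\<close> if no algorithm solves the task with a bounded number of
  queries.
\<close>

definition query_complexity ::
  "nat \<Rightarrow> (nat \<Rightarrow> real set \<Rightarrow> real) set \<Rightarrow> ((nat \<Rightarrow> real set \<Rightarrow> real) \<Rightarrow> 'o \<Rightarrow> bool) \<Rightarrow> enat" where
  "query_complexity n \<V> ok =
     (INF A\<in>{A. legal n A \<and> solves \<V> ok A}. SUP V\<in>\<V>. enat (query_count V A))"

text \<open>
  The conversion to reals sends \<open>\<infinity>\<close> to \<open>0\<close>, so membership of this function of \<open>n\<close> in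
  \<open>\<Theta>(n\<^sup>2)\<close> entails that the complexity is finite for all large \<open>n\<close>.
\<close>

definition queries_required ::
  "nat \<Rightarrow> (nat \<Rightarrow> real set \<Rightarrow> real) set \<Rightarrow> ((nat \<Rightarrow> real set \<Rightarrow> real) \<Rightarrow> 'o \<Rightarrow> bool) \<Rightarrow> real" where
  "queries_required n \<V> ok = real_of_ereal (ereal_of_enat (query_complexity n \<V> ok))"

definition decision_queries :: "nat \<Rightarrow> real" where
  "decision_queries n = queries_required n (hungry_profiles n)
     (\<lambda>V answer. answer \<longleftrightarrow> (\<exists>X. connected_sp_allocation n V X))"

text \<open>
  Two readings of computing an allocation if it exists: the algorithm is only run on profiles
  admitting one, or it is run on all profiles and returns \<^const>\<open>None\<close> if there is none.
\<close>

definition computation_queries :: "nat \<Rightarrow> real" where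
  "computation_queries n = queries_required n
     {V \<in> hungry_profiles n. \<exists>X. connected_sp_allocation n V X}
     (\<lambda>V X. connected_sp_allocation n V X)"

definition computation_or_refutation_queries :: "nat \<Rightarrow> real" where
  "computation_or_refutation_queries n = queries_required n (hungry_profiles n)
     (\<lambda>V answer. case answer of
        Some X \<Rightarrow> connected_sp_allocation n V X
      | None \<Rightarrow> \<not> (\<exists>X. connected_sp_allocation n V X))"

end

theory Submission
  imports Defs
begin

text \<open>
  Call the point where an agent has accumulated value \<open>k/n\<close> her \<open>k\<close>-th mark. A connected
  strongly-proportional allocation exists iff the agents do not share all their marks. If they
  do, each piece has a common inner mark in its interior, and there are only \<open>n - 1\<close> of these.
  If two agents differ at some mark, cut pieces of value \<open>1/n\<close> from the left, each time serving an
  agent who is content with the smallest piece. Until the first disagreement the two agents are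
  kept in the game; it leaves somebody with more than a proportional share of the rest, and ties
  can be broken so that this remains true to the end. The surplus of the last agent is then
  passed on from right to left by small shifts of the cuts. All this takes \<open>O(n\<^sup>2)\<close> queries.

  Conversely, answer all queries as if the valuations were uniform. A query concerns at most two
  points of one agent, so after fewer than \<open>n (n - 1) / 2\<close> queries some mark of some agent is
  untouched; moving it slightly in either direction is consistent with all answers and makes an
  allocation exist, but an allocation good for both moves would be good for the uniform profile.
\<close>

section \<open>Hungry valuations\<close>

text \<open>For a hungry valuation this distribution function is continuous and strictly increasing,
  and it determines the answers to all queries.\<close>

definition cum :: "(real set \<Rightarrow> real) \<Rightarrow> real \<Rightarrow> real" where
  "cum V x = V {0..x}"

lemma interval_in_cake_algebra: "is_interval I \<Longrightarrow> I \<subseteq> cake \<Longrightarrow> I \<in> cake_algebra"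
  unfolding cake_algebra_def by (rule hull_inc) simp

lemma valuation_Un:
  assumes "valuation V" "is_interval A" "is_interval B" "A \<subseteq> cake" "B \<subseteq> cake" "A \<inter> B = {}"
  shows "V (A \<union> B) = V A + V B"
  using assms interval_in_cake_algebra unfolding valuation_def Measure_Space.additive_def by blast

lemma valuation_nonneg:
  assumes "valuation V" "is_interval A" "A \<subseteq> cake"
  shows "0 \<le> V A"
  using assms interval_in_cake_algebra unfolding valuation_def by blast

lemma cum_0: "valuation V \<Longrightarrow> cum V 0 = 0"
  by (simp add: cum_def valuation_def)

lemma cum_1: "valuation V \<Longrightarrow> cum V 1 = 1"
  by (simp add: cum_def valuation_def cake_def)

lemma continuous_on_cum: "valuation V \<Longrightarrow> continuous_on cake (cum V)"
  by (simp add: cum_def[abs_def] valuation_def)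

lemma cum_split:
  assumes "valuation V" "0 \<le> x" "x \<le> y" "y \<le> 1"
  shows "cum V y = cum V x + V {x<..y}"
proof -
  have "{0..y} = {0..x} \<union> {x<..y}" using assms by auto
  then show ?thesis
    using valuation_Un[of V "{0..x}" "{x<..y}"] assms
    by (simp add: cum_def cake_def is_interval_oc is_interval_cc subset_eq disjoint_iff)
qed

text \<open>By additivity a point \<open>x > 0\<close> is worth at most the interval
  \<open>{y<..x}\<close> for every \<open>y < x\<close>, and these values tend to 0 by continuity of
  \<open>cum V\<close>. At 0 the claim is part of the definition.\<close>

lemma valuation_singleton:
  assumes V: "valuation V" and x: "x \<in> cake"
  shows "V {x} = 0"
proof (cases "x = 0")
  case True
  then show ?thesis using V by (simp add: valuation_def)
next
  case False
  with x have x: "0 < x" "x \<le> 1" by (auto simp: cake_def)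
  have le: "V {x} \<le> cum V x - cum V y" if "0 \<le> y" "y < x" for y
  proof -
    have "{y<..x} = {y<..<x} \<union> {x}" using that by auto
    then have "V {y<..x} = V {y<..<x} + V {x}"
      using valuation_Un[of V "{y<..<x}" "{x}"] is_interval_cc[of x x] V that x
      by (simp add: cake_def is_interval_oo subset_eq)
    moreover have "0 \<le> V {y<..<x}"
      using valuation_nonneg[OF V, of "{y<..<x}"] that x
      by (simp add: cake_def is_interval_oo subset_eq)
    ultimately show ?thesis using cum_split[OF V, of y x] that x by simp
  qed
  have "(cum V \<longlongrightarrow> cum V x) (at x within cake)"
    using continuous_on_cum[OF V] x by (auto simp: continuous_on_def cake_def)
  then have "(cum V \<longlongrightarrow> cum V x) (at x within {0..<x})"
    by (rule tendsto_within_subset) (use x in \<open>auto simp: cake_def\<close>)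
  moreover have "at x within {0..<x} = at_left x"
    using x by (intro at_within_nhd[of _ "{0<..}"]) auto
  ultimately have "((\<lambda>y. cum V x - cum V y) \<longlongrightarrow> cum V x - cum V x) (at_left x)"
    by (intro tendsto_diff tendsto_const) simp
  moreover have "eventually (\<lambda>y. V {x} \<le> cum V x - cum V y) (at_left x)"
    using eventually_at_left_real[OF x(1)] by eventually_elim (auto intro: le)
  ultimately have "V {x} \<le> cum V x - cum V x"
    by (intro tendsto_lowerbound[of _ _ "at_left x"]) auto
  then show ?thesis using valuation_nonneg[OF V, of "{x}"] is_interval_cc[of x x] x
    by (simp add: cake_def)
qed

lemma valuation_interval:
  assumes V: "valuation V" and xy: "0 \<le> x" "x \<le> y" "y \<le> 1"
  shows "V {x..y} = cum V y - cum V x"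
proof -
  have "{x..y} = {x} \<union> {x<..y}" using xy by auto
  then have "V {x..y} = V {x} + V {x<..y}"
    using valuation_Un[of V "{x}" "{x<..y}"] is_interval_cc[of x x] V xy
    by (simp add: cake_def is_interval_oc subset_eq)
  then show ?thesis using cum_split[OF assms] valuation_singleton[OF V, of x] xy
    by (simp add: cake_def)
qed

lemma cum_strict_mono:
  assumes "valuation V" "hungry V" "0 \<le> x" "x < y" "y \<le> 1"
  shows "cum V x < cum V y"
proof -
  have "0 < V {x..y}"
    using assms by (auto simp: hungry_def cake_def is_interval_cc)
  then show ?thesis using valuation_interval[of V x y] assms by simp
qed

lemma cum_less_iff:
  assumes "valuation V" "hungry V" "x \<in> cake" "y \<in> cake"
  shows "cum V x < cum V y \<longleftrightarrow> x < y"
  using cum_strict_mono[OF assms(1,2), of x y] cum_strict_mono[OF assms(1,2), of y x] assms(3,4)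
  by (cases x y rule: linorder_cases) (auto simp: cake_def)

lemma cum_le_iff:
  assumes "valuation V" "hungry V" "x \<in> cake" "y \<in> cake"
  shows "cum V x \<le> cum V y \<longleftrightarrow> x \<le> y"
  using cum_less_iff[OF assms(1,2,4,3)] by (simp add: not_less[symmetric])

lemma cum_eq_iff:
  assumes "valuation V" "hungry V" "x \<in> cake" "y \<in> cake"
  shows "cum V x = cum V y \<longleftrightarrow> x = y"
  using cum_le_iff[OF assms] cum_le_iff[OF assms(1,2,4,3)] by auto

section \<open>Answers to Mark queries\<close>

text \<open>Strict monotonicity of \<open>cum V\<close> leaves only one candidate to the right of
  \<open>x\<close>.\<close>

lemma mark_query_eq:
  assumes V: "valuation V" "hungry V" and "x \<in> cake" "z \<in> cake" "0 \<le> r" "cum V z = cum V x + r"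
  shows "mark_query V x r = ereal z"
proof -
  have xz: "x \<le> z" using cum_le_iff[OF V, of x z] assms by simp
  have "cum V z \<le> cum V 1" using cum_le_iff[OF V, of z 1] assms by (simp add: cake_def)
  then have "\<not> V {x..1} < r"
    using valuation_interval[OF V(1), of x 1] assms by (simp add: cake_def)
  moreover have "(GREATEST z. z \<in> cake \<and> V {x..z} = r) = z"
  proof (rule Greatest_equality)
    show "z \<in> cake \<and> V {x..z} = r"
      using valuation_interval[OF V(1), of x z] xz assms by (simp add: cake_def)
    show "y \<le> z" if "y \<in> cake \<and> V {x..y} = r" for y
    \<comment> \<open>For \<open>y < x\<close> the interval \<open>{x..y}\<close> is empty and does
      have value \<open>r\<close> if \<open>r = 0\<close>, but such a \<open>y\<close> lies below
      \<open>z\<close> anyway.\<close>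
    proof (cases "x \<le> y")
      case True
      then show ?thesis
        using valuation_interval[OF V(1), of x y] cum_le_iff[OF V, of y z] that assms
        by (simp add: cake_def)
    qed (use xz in simp)
  qed
  ultimately show ?thesis by (simp add: mark_query_def)
qed

lemma mark_query_infinity:
  assumes "valuation V" "x \<in> cake" "1 < cum V x + r"
  shows "mark_query V x r = \<infinity>"
  using valuation_interval[of V x 1] cum_1[of V] assms by (simp add: mark_query_def cake_def)

lemma mark_query_finite:
  assumes V: "valuation V" "hungry V" and "x \<in> cake" "0 \<le> r" "cum V x + r \<le> 1"
  obtains z where "mark_query V x r = ereal z" "z \<in> cake" "cum V z = cum V x + r"
proof -
  have "\<exists>z. x \<le> z \<and> z \<le> 1 \<and> cum V z = cum V x + r"
    using assms cum_1[OF V(1)]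
    by (intro IVT' continuous_on_subset[OF continuous_on_cum[OF V(1)]]) (auto simp: cake_def)
  then obtain z where "x \<le> z" "z \<le> 1" "cum V z = cum V x + r" by blast
  with that mark_query_eq[OF V, of x z r] assms show ?thesis by (auto simp: cake_def)
qed

section \<open>Solvability within a query budget\<close>

primrec bind :: "'a algorithm \<Rightarrow> ('a \<Rightarrow> 'b algorithm) \<Rightarrow> 'b algorithm" where
  "bind (Output out) f = f out"
| "bind (Eval i x y k) f = Eval i x y (\<lambda>a. bind (k a) f)"
| "bind (Mark i x r k) f = Mark i x r (\<lambda>a. bind (k a) f)"

lemma run_bind: "run V (bind A f) = run V (f (run V A))"
  by (induction A) auto

lemma query_count_bind:
  "query_count V (bind A f) = query_count V A + query_count V (f (run V A))"
  by (induction A) auto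

lemma legal_bind: "legal n A \<Longrightarrow> (\<And>a. legal n (f a)) \<Longrightarrow> legal n (bind A f)"
  by (induction A) auto

text \<open>
  The set of profiles \<open>S\<close> plays the role of the information gathered so far: a query splits
  \<open>S\<close> according to its answer, and an output is admissible once it is correct on all of \<open>S\<close>.
\<close>

definition solvable ::
  "nat \<Rightarrow> nat \<Rightarrow> (nat \<Rightarrow> real set \<Rightarrow> real) set \<Rightarrow> ((nat \<Rightarrow> real set \<Rightarrow> real) \<Rightarrow> 'o \<Rightarrow> bool) \<Rightarrow> bool"
  where "solvable n N S ok \<longleftrightarrow>
    (\<exists>A. legal n A \<and> (\<forall>V\<in>S. ok V (run V A) \<and> query_count V A \<le> N))"

lemma solvable_output: "(\<And>V. V \<in> S \<Longrightarrow> ok V out) \<Longrightarrow> solvable n N S ok"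
  unfolding solvable_def by (rule exI[of _ "Output out"]) simp

lemma solvable_mono:
  assumes "solvable n N S ok" "S' \<subseteq> S" "N \<le> N'" "\<And>V out. V \<in> S' \<Longrightarrow> ok V out \<Longrightarrow> ok' V out"
  shows "solvable n N' S' ok'"
  using assms unfolding solvable_def by (meson le_trans subset_iff)

text \<open>After the query the algorithm may depend on the answer: choosing a solution for each
  \<open>a\<close> yields the subtrees of the new node.\<close>

lemma solvable_eval:
  assumes "i \<in> {1..n}" "x \<in> cake" "y \<in> cake" "x \<le> y"
    and "\<And>a. solvable n N {V \<in> S. V i {x..y} = a} ok"
  shows "solvable n (Suc N) S ok"
proof -
  obtain k where "\<And>a. legal n (k a)"
    "\<And>a V. V \<in> S \<Longrightarrow> V i {x..y} = a \<Longrightarrow> ok V (run V (k a)) \<and> query_count V (k a) \<le> N"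
    using assms(5) unfolding solvable_def by simp metis
  then show ?thesis unfolding solvable_def
    using assms by (intro exI[of _ "Eval i x y k"]) (auto simp: eval_query_def)
qed

lemma solvable_mark:
  assumes "i \<in> {1..n}" "x \<in> cake" "0 \<le> r"
    and "\<And>a. solvable n N {V \<in> S. mark_query (V i) x r = a} ok"
  shows "solvable n (Suc N) S ok"
proof -
  obtain k where "\<And>a. legal n (k a)"
    "\<And>a V. V \<in> S \<Longrightarrow> mark_query (V i) x r = a \<Longrightarrow> ok V (run V (k a)) \<and> query_count V (k a) \<le> N"
    using assms(4) unfolding solvable_def by simp metis
  then show ?thesis unfolding solvable_def
    using assms by (intro exI[of _ "Mark i x r k"]) auto
qed

text \<open>A non-adaptive batch of Mark queries from a common point \<open>x\<close>, by induction
  on \<open>Q\<close>. All answers are known afterwards and collected in \<open>m\<close>.\<close>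

lemma solvable_marks:
  assumes "finite Q" "\<And>i r. (i, r) \<in> Q \<Longrightarrow> i \<in> {1..n} \<and> 0 \<le> r" "x \<in> cake"
    and "\<And>m. solvable n N {V \<in> S. \<forall>(i, r)\<in>Q. mark_query (V i) x r = m i r} ok"
  shows "solvable n (card Q + N) S ok"
  using assms
proof (induction Q arbitrary: S rule: finite_induct)
  case empty
  then show ?case by simp
next
  case (insert q Q)
  obtain j t where q: "q = (j, t)" by force
  have "solvable n (Suc (card Q + N)) S ok"
  proof (rule solvable_mark)
    show "j \<in> {1..n}" "x \<in> cake" "0 \<le> t" using insert.prems(1,2) q by auto
    fix a
    show "solvable n (card Q + N) {V \<in> S. mark_query (V j) x t = a} ok"
    proof (rule insert.IH)
      fix m
      define m' where "m' i r = (if (i, r) = (j, t) then a else m i r)" for i r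
      have "{V \<in> {V \<in> S. mark_query (V j) x t = a}. \<forall>(i, r)\<in>Q. mark_query (V i) x r = m i r} =
        {V \<in> S. \<forall>(i, r)\<in>insert q Q. mark_query (V i) x r = m' i r}"
        using insert.hyps(2) q by (auto simp: m'_def)
      then show "solvable n N {V \<in> {V \<in> S. mark_query (V j) x t = a}.
          \<forall>(i, r)\<in>Q. mark_query (V i) x r = m i r} ok"
        using insert.prems(3)[of m'] by simp
    qed (use insert.prems in auto)
  qed
  then show ?case using insert.hyps by simp
qed

text \<open>The second phase receives the output \<open>a\<close> of the first; all it may rely on
  is that \<open>a\<close> is correct for the profile, not how it was found.\<close>

lemma solvable_bind:
  assumes "solvable n N S ok" "\<And>a. solvable n M {V \<in> S. ok V a} ok'"
  shows "solvable n (N + M) S ok'"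
proof -
  obtain A where A: "legal n A" "\<And>V. V \<in> S \<Longrightarrow> ok V (run V A) \<and> query_count V A \<le> N"
    using assms(1) unfolding solvable_def by blast
  obtain f where f: "\<And>a. legal n (f a)"
    "\<And>a V. V \<in> S \<Longrightarrow> ok V a \<Longrightarrow> ok' V (run V (f a)) \<and> query_count V (f a) \<le> M"
    using assms(2) unfolding solvable_def by simp metis
  show ?thesis unfolding solvable_def
    using A f by (intro exI[of _ "bind A f"])
      (auto simp: run_bind query_count_bind legal_bind intro!: add_mono)
qed

text \<open>Facts that do not mention the profile, such as the order of two known points, can thus
  be read off any profile still possible.\<close>

lemma solvable_nonempty: "(S \<noteq> {} \<Longrightarrow> solvable n N S ok) \<Longrightarrow> solvable n N S ok"
  by (cases "S = {}") (auto intro: solvable_output[where out = undefined])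

lemma solvable_map:
  assumes "solvable n N S ok" "\<And>V a. V \<in> S \<Longrightarrow> ok V a \<Longrightarrow> ok' V (f a)"
  shows "solvable n N S ok'"
proof -
  have "solvable n 0 {V \<in> S. ok V a} ok'" for a
    using assms(2) by (intro solvable_output[where out = "f a"]) auto
  from solvable_bind[OF assms(1) this] show ?thesis by simp
qed

section \<open>From query budgets to worst-case complexity\<close>

lemma query_complexity_le:
  assumes "solvable n N S ok"
  shows "query_complexity n S ok \<le> enat N"
proof -
  obtain A where "legal n A" "\<forall>V\<in>S. ok V (run V A) \<and> query_count V A \<le> N"
    using assms unfolding solvable_def by blast
  then show ?thesis unfolding query_complexity_def solves_def
    by (intro INF_lower2[of A] SUP_least) auto
qed

lemma query_complexity_ge:
  assumes "\<And>A. legal n A \<Longrightarrow> solves S ok A \<Longrightarrow> \<exists>V\<in>S. N \<le> query_count V A"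
  shows "enat N \<le> query_complexity n S ok"
  unfolding query_complexity_def
proof (rule INF_greatest)
  fix A assume "A \<in> {A. legal n A \<and> solves S ok A}"
  then obtain V where "V \<in> S" "N \<le> query_count V A" using assms[of A] by auto
  then show "enat N \<le> (SUP V\<in>S. enat (query_count V A))" by (intro SUP_upper2) auto
qed

text \<open>The upper bound makes the complexity finite, so that the conversion to reals preserves
  it.\<close>

lemma queries_required_bounds:
  assumes "enat N \<le> query_complexity n S ok" "query_complexity n S ok \<le> enat M"
  shows "real N \<le> queries_required n S ok" "queries_required n S ok \<le> real M"
proof -
  obtain q where "query_complexity n S ok = enat q"
    using assms(2) by (cases "query_complexity n S ok") auto
  with assms show "real N \<le> queries_required n S ok" "queries_required n S ok \<le> real M"
    by (auto simp: queries_required_def)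
qed

section \<open>Connected strongly-proportional allocations\<close>

lemma hungry_profilesD:
  assumes "V \<in> hungry_profiles n" "i \<in> {1..n}"
  shows "valuation (V i)" "hungry (V i)"
  using assms by (auto simp: hungry_profiles_def)

text \<open>An interval worth more than \<open>1 / n\<close> has a mark in its interior. With
  \<open>n\<close> pieces and \<open>n - 1\<close> common marks, two pieces share an interior point,
  although distinct pieces meet only in their frontiers.\<close>

lemma no_sp_allocation_if_common_marks:
  assumes V: "V \<in> hungry_profiles n" and n: "0 < n"
    and m: "\<And>k i. k \<in> {1..<n} \<Longrightarrow> i \<in> {1..n} \<Longrightarrow> m k \<in> cake \<and> cum (V i) (m k) = real k / real n"
  shows "\<not> connected_sp_allocation n V X"
proof
  assume X: "connected_sp_allocation n V X"
  then have "allocation n X"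
    and closed: "\<And>i. i \<in> {1..n} \<Longrightarrow> closed_interval (X i)"
    and sp: "\<And>i. i \<in> {1..n} \<Longrightarrow> V i (X i) > 1 / real n"
    by (simp_all add: connected_sp_allocation_def connected_allocation_def
        strongly_proportional_def equal_entitlements_def)
  then have cover: "(\<Union>i\<in>{1..n}. X i) = cake"
    and disj: "\<And>i j. i \<in> {1..n} \<Longrightarrow> j \<in> {1..n} \<Longrightarrow> i \<noteq> j \<Longrightarrow> X i \<inter> X j \<subseteq> frontier (X i)"
    by (simp_all add: allocation_def)
  have "\<exists>k\<in>{1..<n}. m k \<in> interior (X i)" if i: "i \<in> {1..n}" for i
  proof -
    note Vi = hungry_profilesD[OF V i]
    obtain a b where ab: "a \<le> b" "X i = {a..b}"
      using closed[OF i] by (auto simp: closed_interval_def)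
    moreover have "X i \<subseteq> cake" using cover i by blast
    ultimately have ab01: "0 \<le> a" "b \<le> 1" by (auto simp: cake_def)
    have large: "cum (V i) b - cum (V i) a > 1 / real n"
      using sp[OF i] valuation_interval[OF Vi(1), of a b] ab ab01 by simp
    have a0: "0 \<le> cum (V i) a"
      using cum_le_iff[OF Vi, of 0 a] cum_0[OF Vi(1)] ab ab01 by (simp add: cake_def)
    have b1: "cum (V i) b \<le> 1"
      using cum_le_iff[OF Vi, of b 1] cum_1[OF Vi(1)] ab ab01 by (simp add: cake_def)
    \<comment> \<open>The first mark strictly to the right of \<open>a\<close>: rounding down and
      adding 1 exceeds \<open>n * cum (V i) a\<close> strictly, but by at most 1, whereas the piece
      is worth more than \<open>1 / n\<close>.\<close>
    define k where "k = Suc (nat \<lfloor>real n * cum (V i) a\<rfloor>)"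
    have "real k = of_int \<lfloor>real n * cum (V i) a\<rfloor> + 1"
      using a0 by (simp add: k_def)
    then have "real n * cum (V i) a < real k" "real k \<le> real n * cum (V i) a + 1"
      by linarith+
    then have k: "cum (V i) a < real k / real n" "real k / real n < cum (V i) b"
      using n large by (auto simp: field_simps)
    with b1 have "real k / real n < 1" by simp
    then have kn: "k \<in> {1..<n}" using n by (auto simp: k_def)
    then have "a < m k" "m k < b"
      using cum_less_iff[OF Vi, of a "m k"] cum_less_iff[OF Vi, of "m k" b] k m[OF kn i] ab ab01
      by (auto simp: cake_def)
    then show ?thesis using kn ab by auto
  qed
  then obtain f where f: "\<And>i. i \<in> {1..n} \<Longrightarrow> f i \<in> {1..<n} \<and> m (f i) \<in> interior (X i)"
    by metis
  have "\<not> inj_on f {1..n}"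
    by (rule pigeonhole) (use f n card_mono[of "{1..<n}" "f ` {1..n}"] in force)
  then obtain i j where "i \<in> {1..n}" "j \<in> {1..n}" "i \<noteq> j" "f i = f j"
    by (auto simp: inj_on_def)
  then show False
    using f[of i] f[of j] disj[of i j] interior_subset by (force simp: frontier_def)
qed

section \<open>Connected partitions of a right-hand remainder\<close>

text \<open>The recursive form of a connected allocation: the agents in \<open>R\<close> share the
  remainder \<open>{s..1}\<close>. All agents and \<open>s = 0\<close> give the original
  notion.\<close>

definition tiling :: "nat set \<Rightarrow> real \<Rightarrow> (nat \<Rightarrow> real set) \<Rightarrow> bool" where
  "tiling R s X \<longleftrightarrow> (\<forall>i\<in>R. closed_interval (X i)) \<and> (\<Union>i\<in>R. X i) = {s..1} \<and>
     (\<forall>i\<in>R. \<forall>j\<in>R. i \<noteq> j \<longrightarrow> X i \<inter> X j \<subseteq> frontier (X i) \<inter> frontier (X j))"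

lemma frontier_Icc: "a \<le> b \<Longrightarrow> frontier {a..b} = {a, b :: real}"
  using frontier_cbox[of a b] by auto

text \<open>The other pieces lie to the right of \<open>m\<close>, so the new one can meet them only
  in \<open>m\<close>, an end of both.\<close>

lemma tiling_insert:
  assumes X: "tiling R m X" and b: "b \<notin> R" and sm: "s \<le> m" "m \<le> 1"
  shows "tiling (insert b R) s (X(b := {s..m}))"
proof -
  have sub: "X j \<subseteq> {m..1}" if "j \<in> R" for j using X that unfolding tiling_def by blast
  have meet: "{s..m} \<inter> X j \<subseteq> frontier {s..m} \<inter> frontier (X j)" if j: "j \<in> R" for j
  proof -
    obtain c d where cd: "c \<le> d" "X j = {c..d}"
      using X j by (auto simp: tiling_def closed_interval_def)
    then show ?thesis using sub[OF j] sm by (auto simp: frontier_Icc)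
  qed
  have "(\<Union>i\<in>insert b R. (X(b := {s..m})) i) = {s..m} \<union> (\<Union>i\<in>R. X i)"
    using b by auto
  also have "\<dots> = {s..1}" using X sm by (auto simp: tiling_def)
  finally have cover: "(\<Union>i\<in>insert b R. (X(b := {s..m})) i) = {s..1}" .
  have meet': "X j \<inter> {s..m} \<subseteq> frontier (X j) \<inter> frontier {s..m}" if "j \<in> R" for j
    using meet[OF that] by blast
  have "\<forall>i\<in>insert b R. closed_interval ((X(b := {s..m})) i)"
    using X sm by (auto simp: tiling_def closed_interval_def)
  moreover have "\<forall>i\<in>insert b R. \<forall>j\<in>insert b R. i \<noteq> j \<longrightarrow>
      (X(b := {s..m})) i \<inter> (X(b := {s..m})) j \<subseteq> frontier ((X(b := {s..m})) i) \<inter> frontier ((X(b := {s..m})) j)"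
    using X b meet meet' by (simp add: tiling_def)
  ultimately show ?thesis using cover unfolding tiling_def by blast
qed

lemma connected_allocation_tiling:
  assumes "tiling {1..n} 0 X"
  shows "connected_allocation n X"
proof -
  have "\<exists>\<I>. finite \<I> \<and> (\<forall>I\<in>\<I>. closed_interval I) \<and> X i = \<Union>\<I>" if "i \<in> {1..n}" for i
    using assms that by (intro exI[of _ "{X i}"]) (auto simp: tiling_def)
  then show ?thesis
    using assms by (simp add: connected_allocation_def allocation_def tiling_def cake_def)
qed

section \<open>Cutting from the left and passing the surplus back\<close>

text \<open>Half of the surplus of \<open>b\<close> is given away at the left end: an Eval query
  measures the surplus, a Mark query finds the new cut. The other half keeps the bound
  strict.\<close>

lemma solvable_shift:
  assumes S: "S \<subseteq> hungry_profiles n" and b: "b \<in> {1..n}" and sm: "0 \<le> s" "s \<le> m" "m \<le> 1"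
    and gt: "\<And>V. V \<in> S \<Longrightarrow> cum (V b) m - cum (V b) s > 1 / real n"
  shows "solvable n 2 S (\<lambda>V s'. s < s' \<and> s' < m \<and> cum (V b) m - cum (V b) s' > 1 / real n)"
    (is "solvable n 2 S ?ok")
proof -
  have "solvable n (Suc (Suc 0)) S ?ok"
  proof (rule solvable_eval)
    show "b \<in> {1..n}" "s \<in> cake" "m \<in> cake" "s \<le> m" using b sm by (auto simp: cake_def)
    fix v
    show "solvable n (Suc 0) {V \<in> S. V b {s..m} = v} ?ok"
    proof (cases "v > 1 / real n")
      case True
      define r where "r = (v - 1 / real n) / 2"
      have r: "0 < r" "v - r > 1 / real n" using True by (auto simp: r_def field_simps)
      show ?thesis
      proof (rule solvable_mark)
        show "b \<in> {1..n}" "s \<in> cake" "0 \<le> r" using b sm r by (auto simp: cake_def)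
        fix a
        show "solvable n 0 {V \<in> {V \<in> S. V b {s..m} = v}. mark_query (V b) s r = a} ?ok"
        proof (rule solvable_output)
          fix V assume "V \<in> {V \<in> {V \<in> S. V b {s..m} = v}. mark_query (V b) s r = a}"
          then have V: "V \<in> S" "V b {s..m} = v" "mark_query (V b) s r = a" by auto
          note Vb = hungry_profilesD[OF subsetD[OF S V(1)] b]
          have v: "cum (V b) m = cum (V b) s + v"
            using valuation_interval[OF Vb(1) sm] V(2) by simp
          have "cum (V b) m \<le> 1"
            using cum_le_iff[OF Vb, of m 1] cum_1[OF Vb(1)] sm by (simp add: cake_def)
          moreover have vr: "v > r" using r order.strict_trans1[of 0 "1 / real n" "v - r"] by simp
          ultimately obtain z where z: "a = ereal z" "z \<in> cake" "cum (V b) z = cum (V b) s + r"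
            using mark_query_finite[OF Vb, of s r] r v V(3) sm by (auto simp: cake_def)
          have "s < z" "z < m"
            using cum_less_iff[OF Vb, of s z] cum_less_iff[OF Vb, of z m] z r v vr sm
            by (auto simp: cake_def)
          then show "?ok V (real_of_ereal a)" using z v r by simp
        qed
      qed
    next
      case False
      \<comment> \<open>By \<open>gt\<close> no profile in \<open>S\<close> gives such an answer, so
        any output will do.\<close>
      then have "{V \<in> S. V b {s..m} = v} = {}"
        using gt valuation_interval[OF hungry_profilesD(1)[OF _ b] sm] S by fastforce
      then show ?thesis by (intro solvable_output[where out = undefined]) auto
    qed
  qed
  then show ?thesis by (simp add: numeral_2_eq_2)
qed

text \<open>
  The witnesses of the surplus or of the disagreement about a mark are quantified before the
  profile: the algorithm has to know them from the answers received so far.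
\<close>

definition divisible ::
  "nat \<Rightarrow> (nat \<Rightarrow> real set \<Rightarrow> real) set \<Rightarrow> nat set \<Rightarrow> real \<Rightarrow> bool" where
  "divisible n S R s \<longleftrightarrow> S \<subseteq> hungry_profiles n \<and> R \<subseteq> {1..n} \<and> s \<in> cake \<and>
     (\<forall>V\<in>S. \<forall>i\<in>R. real (card R) / real n \<le> 1 - cum (V i) s) \<and>
     ((\<exists>a\<in>R. \<forall>V\<in>S. real (card R) / real n < 1 - cum (V a) s) \<or>
      (\<exists>i\<in>R. \<exists>j\<in>R. \<exists>y\<in>cake. \<exists>k. 0 < k \<and> k < card R \<and>
        (\<forall>V\<in>S. cum (V i) y - cum (V i) s = real k / real n \<and>
               cum (V j) y - cum (V j) s \<noteq> real k / real n)))"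

text \<open>One round: every remaining agent marks the end of a piece worth \<open>1 / n\<close>
  starting at \<open>s\<close>, and an agent \<open>b\<close> with the smallest mark is served.
  Choosing \<open>b\<close> well among ties preserves the invariant; \<open>rest\<close> is the
  continuation of the algorithm.\<close>

lemma solvable_divisible_step:
  assumes div: "divisible n S R s" and R: "2 \<le> card R"
    and rest: "\<And>b m S'. S' \<subseteq> S \<Longrightarrow> b \<in> R \<Longrightarrow> divisible n S' (R - {b}) m \<Longrightarrow>
      (\<And>V. V \<in> S' \<Longrightarrow> cum (V b) m - cum (V b) s = 1 / real n) \<Longrightarrow> solvable n N S' ok"
  shows "solvable n (card R + N) S ok"
proof -
  have S: "S \<subseteq> hungry_profiles n" and Rn: "R \<subseteq> {1..n}" and s: "s \<in> cake"
    and share: "\<And>V i. V \<in> S \<Longrightarrow> i \<in> R \<Longrightarrow> real (card R) / real n \<le> 1 - cum (V i) s"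
    using div by (auto simp: divisible_def)
  have fin: "finite R" using Rn finite_subset by blast
  have n: "0 < n" using Rn R card_mono[of "{1..n}" R] by auto
  have card: "card (R - {b}) = card R - 1"
    "real (card (R - {b})) / real n = real (card R) / real n - 1 / real n"
    if "b \<in> R" for b
    using that R fin by (auto simp: of_nat_diff diff_divide_distrib)
  have "solvable n (card (R \<times> {1 / real n}) + N) S ok"
  proof (rule solvable_marks[where x = s])
    show "finite (R \<times> {1 / real n})" "s \<in> cake" using fin s by auto
    show "i \<in> {1..n} \<and> 0 \<le> r" if "(i, r) \<in> R \<times> {1 / real n}" for i r using that Rn by auto
    fix \<mu> :: "nat \<Rightarrow> real \<Rightarrow> ereal"
    define S' where "S' = {V \<in> S. \<forall>(i, r)\<in>R \<times> {1 / real n}. mark_query (V i) s r = \<mu> i r}"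
    define m where "m i = real_of_ereal (\<mu> i (1 / real n))" for i
    have S'S: "S' \<subseteq> S" by (auto simp: S'_def)
    show "solvable n N {V \<in> S. \<forall>(i, r)\<in>R \<times> {1 / real n}. mark_query (V i) s r = \<mu> i r} ok"
    proof (cases "S' = {}")
      case True
      then show ?thesis unfolding S'_def[symmetric] by (intro solvable_output[where out = undefined]) auto
    next
      case False
      then obtain V0 where V0: "V0 \<in> S'" by blast
      have m: "m i \<in> cake \<and> cum (V i) (m i) = cum (V i) s + 1 / real n"
        if "V \<in> S'" "i \<in> R" for V i
      proof -
        have VS: "V \<in> S" and mark: "mark_query (V i) s (1 / real n) = \<mu> i (1 / real n)"
          using that by (auto simp: S'_def)
        have i: "i \<in> {1..n}" using that Rn by blast
        note Vi = hungry_profilesD[OF subsetD[OF S VS] i]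
        have "1 / real n \<le> real (card R) / real n" using R by (intro divide_right_mono) auto
        then have "cum (V i) s + 1 / real n \<le> 1" using share[OF VS that(2)] by simp
        then obtain z where "mark_query (V i) s (1 / real n) = ereal z" "z \<in> cake"
            "cum (V i) z = cum (V i) s + 1 / real n"
          using mark_query_finite[OF Vi s, of "1 / real n"] by auto
        then show ?thesis using mark by (simp add: m_def)
      qed
      have hungryS': "valuation (V i)" "hungry (V i)" if "V \<in> S'" "i \<in> R" for V i
        using that S'S S Rn hungry_profilesD[of V n i] by blast+
      have le: "cum (V i) x - cum (V i) s \<le> 1 / real n \<longleftrightarrow> x \<le> m i"
        and less: "cum (V i) x - cum (V i) s < 1 / real n \<longleftrightarrow> x < m i"
        if "V \<in> S'" "i \<in> R" "x \<in> cake" for V i x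
        using cum_le_iff[OF hungryS'[OF that(1,2)], of x "m i"]
          cum_less_iff[OF hungryS'[OF that(1,2)], of x "m i"] m[OF that(1,2)] that(3) by linarith+
      \<comment> \<open>A piece that ends at the smallest mark is worth at most \<open>1 / n\<close>
        to everybody, so the others can still expect proportional shares of the rest.\<close>
      have minimal: "\<forall>V\<in>S'. \<forall>i\<in>R - {b}. real (card (R - {b})) / real n \<le> 1 - cum (V i) (m b)"
        if "b \<in> R" "\<And>i. i \<in> R \<Longrightarrow> m b \<le> m i" for b
      proof (intro ballI)
        fix V i assume *: "V \<in> S'" "i \<in> R - {b}"
        then show "real (card (R - {b})) / real n \<le> 1 - cum (V i) (m b)"
          using le[of V i "m b"] share[of V i] S'S m[of V b] that(1) that(2)[of i] card[of b] by fastforce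
      qed
      \<comment> \<open>In three of the four cases below, the invariant survives through an agent
        \<open>a\<close> with a surplus after \<open>b\<close> has left.\<close>
      have surplus: "solvable n N S' ok"
        if "b \<in> R" "\<And>i. i \<in> R \<Longrightarrow> m b \<le> m i" "a \<in> R" "a \<noteq> b"
          "\<And>V. V \<in> S' \<Longrightarrow> real (card R) / real n - 1 / real n < 1 - cum (V a) (m b)" for a b
      proof (rule rest[of S' b "m b"])
        show "divisible n S' (R - {b}) (m b)"
          unfolding divisible_def
        proof (intro conjI)
          show "m b \<in> cake" using m[OF V0 that(1)] by blast
          show "(\<exists>a\<in>R - {b}. \<forall>V\<in>S'. real (card (R - {b})) / real n < 1 - cum (V a) (m b)) \<or>
              (\<exists>i\<in>R - {b}. \<exists>j\<in>R - {b}. \<exists>y\<in>cake. \<exists>k. 0 < k \<and> k < card (R - {b}) \<and>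
                (\<forall>V\<in>S'. cum (V i) y - cum (V i) (m b) = real k / real n \<and>
                  cum (V j) y - cum (V j) (m b) \<noteq> real k / real n))"
            using that card[OF that(1)] by (intro disjI1 bexI[of _ a]) auto
        qed (use S'S S Rn minimal that in auto)
      qed (use S'S that m in auto)
      obtain b where b: "b \<in> R" "\<And>i. i \<in> R \<Longrightarrow> m b \<le> m i"
      proof
        have "R \<noteq> {}" using R by auto
        from arg_min_if_finite[OF fin this, of m]
        show "arg_min_on m R \<in> R" "\<And>i. i \<in> R \<Longrightarrow> m (arg_min_on m R) \<le> m i"
          by force+
      qed
      have "solvable n N S' ok"
      proof (cases "\<exists>a\<in>R. \<forall>V\<in>S. real (card R) / real n < 1 - cum (V a) s")
        case True
        then obtain a where a: "a \<in> R" "\<And>V. V \<in> S \<Longrightarrow> real (card R) / real n < 1 - cum (V a) s"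
          by blast
        show ?thesis
        \<comment> \<open>In a tie another agent is served, and \<open>a\<close> keeps the surplus
          because the piece costs \<open>a\<close> at most \<open>1 / n\<close>.\<close>
        proof (cases "\<exists>b'\<in>R - {a}. m b' = m b")
          case True
          then obtain b' where b': "b' \<in> R" "b' \<noteq> a" "m b' = m b" by blast
          show ?thesis
          proof (rule surplus[of b' a])
            fix V assume V: "V \<in> S'"
            show "real (card R) / real n - 1 / real n < 1 - cum (V a) (m b')"
              using le[OF V a(1), of "m b'"] a(2)[OF subsetD[OF S'S V]] b(2)[OF a(1)] b'(3)
                m[OF V b'(1)] by simp
          qed (use a b b' in auto)
        next
          case False
          with b(1) have ba: "b = a" by blast
          obtain c where c: "c \<in> R" "c \<noteq> a"
          proof -
            have "card (R - {a}) \<noteq> 0" using R card(1)[OF a(1)] by simp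
            then have "R - {a} \<noteq> {}" by (metis card.empty)
            with that show thesis by blast
          qed
          show ?thesis
          proof (rule surplus[of a c])
            fix V assume V: "V \<in> S'"
            have "m c \<noteq> m a" using False c ba by blast
            then have "m a < m c" using b(2)[OF c(1)] ba by simp
            then show "real (card R) / real n - 1 / real n < 1 - cum (V c) (m a)"
              using less[OF V c(1), of "m a"] m[OF V a(1)] share[OF subsetD[OF S'S V] c(1)] by simp
          qed (use a b c ba in auto)
        qed
      next
        case False
        then obtain i j y k where ij: "i \<in> R" "j \<in> R" "y \<in> cake" "0 < k" "k < card R"
          "\<And>V. V \<in> S \<Longrightarrow> cum (V i) y - cum (V i) s = real k / real n"
          "\<And>V. V \<in> S \<Longrightarrow> cum (V j) y - cum (V j) s \<noteq> real k / real n"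
          using div unfolding divisible_def by blast
        show ?thesis
        \<comment> \<open>Unequal marks create a surplus at once: an agent with a later mark values
          the served piece at less than \<open>1 / n\<close>.\<close>
        proof (cases "\<exists>c\<in>R. m c \<noteq> m b")
          case True
          then obtain c where c: "c \<in> R" "m b < m c" using b by force
          show ?thesis
          proof (rule surplus[of b c])
            fix V assume V: "V \<in> S'"
            show "real (card R) / real n - 1 / real n < 1 - cum (V c) (m b)"
              using less[OF V c(1), of "m b"] m[OF V b(1)] share[OF subsetD[OF S'S V] c(1)] c(2) by simp
          qed (use b c in auto)
        next
          case False
          then have eq: "m c = m b" if "c \<in> R" for c using that by blast
          \<comment> \<open>All marks coincide now. If \<open>k\<close> were 1, then
            \<open>y\<close> would be the mark of \<open>i\<close>, hence also that of
            \<open>j\<close>, against their disagreement.\<close>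
          have "k \<noteq> 1"
          proof
            assume "k = 1"
            then have "y = m i"
              using ij(6)[of V0] V0 S'S m[OF V0 ij(1)] cum_eq_iff[OF hungryS'[OF V0 ij(1)], of y "m i"] ij(3)
              by auto
            then show False
              using ij(7)[of V0] V0 S'S m[OF V0 ij(2)] eq[OF ij(1)] eq[OF ij(2)] \<open>k = 1\<close> by auto
          qed
          with ij have k: "2 \<le> k" by simp
          have ij2: "card {i, j} \<le> 2" by (simp add: card_insert_if)
          \<comment> \<open>Since \<open>2 \<le> k < card R\<close>, there is a third agent to
            serve. Both witnesses stay, and their disagreement at \<open>y\<close> turns into one
            about \<open>k - 1\<close>, as each has lost exactly \<open>1 / n\<close>.\<close>
          obtain d where d: "d \<in> R" "d \<noteq> i" "d \<noteq> j"
          proof -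
            have "\<not> R \<subseteq> {i, j}" using k ij(5) card_mono[of "{i, j}" R] ij2 by auto
            with that show thesis by blast
          qed
          have kd: "real (k - 1) / real n = real k / real n - 1 / real n"
            using k by (simp add: of_nat_diff diff_divide_distrib)
          show ?thesis
          proof (rule rest[of S' d "m d"])
            show "divisible n S' (R - {d}) (m d)"
              unfolding divisible_def
            proof (intro conjI)
              show "m d \<in> cake" using m[OF V0 d(1)] by blast
              have "cum (V i) y - cum (V i) (m d) = real (k - 1) / real n \<and>
                  cum (V j) y - cum (V j) (m d) \<noteq> real (k - 1) / real n" if V: "V \<in> S'" for V
                using ij(6)[of V] ij(7)[of V] V S'S m[OF V ij(1)] m[OF V ij(2)] kd
                  eq[OF ij(1)] eq[OF ij(2)] eq[OF d(1)] by auto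
              then show "(\<exists>a\<in>R - {d}. \<forall>V\<in>S'. real (card (R - {d})) / real n < 1 - cum (V a) (m d)) \<or>
                (\<exists>i\<in>R - {d}. \<exists>j\<in>R - {d}. \<exists>y\<in>cake. \<exists>k. 0 < k \<and> k < card (R - {d}) \<and>
                (\<forall>V\<in>S'. cum (V i) y - cum (V i) (m d) = real k / real n \<and>
                  cum (V j) y - cum (V j) (m d) \<noteq> real k / real n))"
                using ij(1-5) k d card[OF d(1)]
                by (intro disjI2 bexI[of _ i] bexI[of _ j] bexI[of _ y] exI[of _ "k - 1"]) auto
            qed (use S'S S Rn minimal[of d] d eq in auto)
          qed (use S'S d m in auto)
        qed
      qed
      then show ?thesis by (simp add: S'_def)
    qed
  qed
  then show ?thesis by (simp add: card_cartesian_product)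
qed

text \<open>The threshold refers to the total number \<open>n\<close> of agents even when
  \<open>R\<close> is smaller.\<close>

definition sp_tiling ::
  "nat \<Rightarrow> (nat \<Rightarrow> real set \<Rightarrow> real) \<Rightarrow> nat set \<Rightarrow> real \<Rightarrow> (nat \<Rightarrow> real set) \<Rightarrow> bool" where
  "sp_tiling n V R s X \<longleftrightarrow> tiling R s X \<and> (\<forall>i\<in>R. V i (X i) > 1 / real n)"

lemma sp_tiling_insert:
  assumes "sp_tiling n V R m X" "b \<notin> R" "0 \<le> s" "s \<le> m" "m \<le> 1" "valuation (V b)"
    and "cum (V b) m - cum (V b) s > 1 / real n"
  shows "sp_tiling n V (insert b R) s (X(b := {s..m}))"
  using assms tiling_insert[of R m X b s] valuation_interval[of "V b" s m]
  by (auto simp: sp_tiling_def)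

lemma connected_sp_allocation_sp_tiling:
  "sp_tiling n V {1..n} 0 X \<Longrightarrow> connected_sp_allocation n V X"
  by (simp add: sp_tiling_def connected_sp_allocation_def connected_allocation_tiling
      strongly_proportional_def equal_entitlements_def)

text \<open>
  Strictness propagates from right to left: the agents served later start at some \<open>s' > s\<close>, so
  an agent who was to receive exactly \<open>1/n\<close> gains a surplus and can pass on a part of it.
\<close>

lemma solvable_divisible:
  assumes "divisible n S R s" "R \<noteq> {}"
  shows "solvable n (card R * (n + 2)) S (\<lambda>V (s', X). s < s' \<and> s' \<le> 1 \<and> sp_tiling n V R s' X)"
  using assms
proof (induction "card R" arbitrary: S R s rule: less_induct)
  case less
  have S: "S \<subseteq> hungry_profiles n" and Rn: "R \<subseteq> {1..n}" and s: "s \<in> cake"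
    using less.prems(1) by (auto simp: divisible_def)
  have fin: "finite R" using Rn finite_subset by blast
  have card_n: "card R \<le> n" using card_mono[OF _ Rn] by simp
  show ?case (is "solvable n _ S ?ok")
  proof (cases "card R = 1")
    case True
    then obtain a where R: "R = {a}" by (auto simp: card_1_singleton_iff)
    \<comment> \<open>For a single agent no \<open>k\<close> satisfies
      \<open>0 < k < card R\<close>, so the invariant can only hold through a surplus.\<close>
    have gt: "cum (V a) 1 - cum (V a) s > 1 / real n" if V: "V \<in> S" for V
    proof -
      have "cum (V a) 1 = 1" using S V Rn R hungry_profilesD[of V n a] cum_1 by auto
      then show ?thesis using less.prems(1) V unfolding divisible_def R by auto
    qed
    have "solvable n (2 + 0) S ?ok"
    proof (rule solvable_bind[OF solvable_shift[of S n a s 1]])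
      fix s'
      show "solvable n 0 {V \<in> S. s < s' \<and> s' < 1 \<and> cum (V a) 1 - cum (V a) s' > 1 / real n} ?ok"
      proof (rule solvable_output)
        fix V assume "V \<in> {V \<in> S. s < s' \<and> s' < 1 \<and> cum (V a) 1 - cum (V a) s' > 1 / real n}"
        then have V: "V \<in> S" "s < s'" "s' < 1" "cum (V a) 1 - cum (V a) s' > 1 / real n" by auto
        have "valuation (V a)" using S V(1) Rn R hungry_profilesD[of V n a] by auto
        then show "?ok V (s', \<lambda>_. {s'..1})"
          using V s valuation_interval[of "V a" s' 1]
          by (auto simp: sp_tiling_def tiling_def R closed_interval_def cake_def)
      qed
    qed (use S Rn R s gt in \<open>auto simp: cake_def\<close>)
    then show ?thesis by (rule solvable_mono) (auto simp: True)
  next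
    case False
    then have R: "2 \<le> card R" using less.prems(2) fin by (cases "card R") auto
    \<comment> \<open>The costs are one round of marks, the recursion for the other agents and two
      queries for the shift. By \<open>card R \<le> n\<close> a level takes at most
      \<open>n + 2\<close> queries.\<close>
    have "solvable n (card R + ((card R - 1) * (n + 2) + 2)) S ?ok"
    proof (rule solvable_divisible_step[OF less.prems(1) R])
      fix b m S'
      assume S': "S' \<subseteq> S" and b: "b \<in> R" and div: "divisible n S' (R - {b}) m"
        and share: "\<And>V. V \<in> S' \<Longrightarrow> cum (V b) m - cum (V b) s = 1 / real n"
      have card: "card (R - {b}) = card R - 1" using b fin by simp
      have bn: "b \<in> {1..n}" using b Rn by blast
      have mc: "m \<in> cake" using div by (simp add: divisible_def)
      have "card (R - {b}) \<noteq> 0" using card R by simp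
      then have "R - {b} \<noteq> {}" by (metis card.empty)
      then have "solvable n ((card R - 1) * (n + 2)) S'
          (\<lambda>V (m', X). m < m' \<and> m' \<le> 1 \<and> sp_tiling n V (R - {b}) m' X)"
        using less.hyps[OF _ div] card R by simp
      then show "solvable n ((card R - 1) * (n + 2) + 2) S' ?ok"
      proof (rule solvable_bind)
        fix mX :: "real \<times> (nat \<Rightarrow> real set)"
        obtain m' X where mX: "mX = (m', X)" by force
        define S'' where "S'' = {V \<in> S'. m < m' \<and> m' \<le> 1 \<and> sp_tiling n V (R - {b}) m' X}"
        have S''V: "V \<in> S'" "valuation (V b)" "hungry (V b)" if "V \<in> S''" for V
          using that S' S hungry_profilesD[OF _ bn, of V] by (auto simp: S''_def)
        have "solvable n 2 S'' ?ok"
        proof (rule solvable_nonempty)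
          assume "S'' \<noteq> {}"
          then obtain V0 where V0: "V0 \<in> S''" by blast
          then have m': "m < m'" "m' \<le> 1" by (auto simp: S''_def)
          have "0 \<le> 1 / real n" by simp
          then have "cum (V0 b) s \<le> cum (V0 b) m" using share[OF S''V(1)[OF V0]] by linarith
          then have sm: "s \<le> m" using cum_le_iff[OF S''V(2,3)[OF V0] s mc] by simp
          have "solvable n (2 + 0) S'' ?ok"
          proof (rule solvable_bind[OF solvable_shift[of S'' n b s m']])
            \<comment> \<open>The piece up to \<open>m\<close> is worth exactly \<open>1 / n\<close>
              to \<open>b\<close>; hunger makes the extension to \<open>m'\<close> a strict
              gain.\<close>
            show "cum (V b) m' - cum (V b) s > 1 / real n" if "V \<in> S''" for V
              using share[OF S''V(1)[OF that]] cum_less_iff[OF S''V(2,3)[OF that] mc, of m'] m' mc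
              by (simp add: cake_def)
            fix s'
            show "solvable n 0 {V \<in> S''. s < s' \<and> s' < m' \<and> cum (V b) m' - cum (V b) s' > 1 / real n} ?ok"
            proof (rule solvable_output)
              fix V assume "V \<in> {V \<in> S''. s < s' \<and> s' < m' \<and> cum (V b) m' - cum (V b) s' > 1 / real n}"
              then have V: "V \<in> S''" "s < s'" "s' < m'" "cum (V b) m' - cum (V b) s' > 1 / real n"
                by auto
              have "sp_tiling n V (insert b (R - {b})) s' (X(b := {s'..m'}))"
                using V s m' S''V(2)[OF V(1)]
                by (intro sp_tiling_insert) (auto simp: S''_def cake_def)
              then show "?ok V (s', X(b := {s'..m'}))"
                using V m' by (simp add: insert_absorb[OF b])
            qed
          qed (use S' S bn s sm m' in \<open>auto simp: cake_def S''_def\<close>)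
          then show "solvable n 2 S'' ?ok" by simp
        qed
        then show "solvable n 2 {V \<in> S'. case mX of (m', X) \<Rightarrow>
            m < m' \<and> m' \<le> 1 \<and> sp_tiling n V (R - {b}) m' X} ?ok"
          by (simp add: mX S''_def)
      qed
    qed
    moreover have "card R + ((card R - 1) * (n + 2) + 2) \<le> card R * (n + 2)"
      using R card_n by (cases "card R") auto
    ultimately show ?thesis by (rule solvable_mono[OF _ subset_refl])
  qed
qed

section \<open>Allocation or refutation with quadratically many queries\<close>

text \<open>The recursion leaves a gap to the right of its starting point, but the leftmost piece
  has to begin at 0. Hence the first round is made separately: its piece is extended to
  \<open>m'\<close> and no shift follows.\<close>

lemma solvable_sp_allocation:
  assumes div: "divisible n S {1..n} 0" and n: "2 \<le> n"
  shows "solvable n (n + (n - 1) * (n + 2)) S (connected_sp_allocation n)"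
proof -
  have "solvable n (card {1..n} + (n - 1) * (n + 2)) S (connected_sp_allocation n)"
  proof (rule solvable_divisible_step[OF div])
    fix b m S'
    assume S': "S' \<subseteq> S" and b: "b \<in> {1..n}" and div': "divisible n S' ({1..n} - {b}) m"
      and share: "\<And>V. V \<in> S' \<Longrightarrow> cum (V b) m - cum (V b) 0 = 1 / real n"
    have mc: "m \<in> cake" using div' by (simp add: divisible_def)
    have card: "card ({1..n} - {b}) = n - 1" using b by simp
    then have "card ({1..n} - {b}) \<noteq> 0" using n by simp
    then have "{1..n} - {b} \<noteq> {}" by (metis card.empty)
    note solvable_divisible[OF div' this]
    then have "solvable n ((n - 1) * (n + 2) + 0) S' (connected_sp_allocation n)"
      unfolding card
    proof (rule solvable_bind)
      fix mX :: "real \<times> (nat \<Rightarrow> real set)"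
      obtain m' X where mX: "mX = (m', X)" by force
      show "solvable n 0 {V \<in> S'. case mX of (m', X) \<Rightarrow>
          m < m' \<and> m' \<le> 1 \<and> sp_tiling n V ({1..n} - {b}) m' X} (connected_sp_allocation n)"
      proof (rule solvable_output)
        fix V assume "V \<in> {V \<in> S'. case mX of (m', X) \<Rightarrow>
          m < m' \<and> m' \<le> 1 \<and> sp_tiling n V ({1..n} - {b}) m' X}"
        then have V: "V \<in> S'" "m < m'" "m' \<le> 1" "sp_tiling n V ({1..n} - {b}) m' X"
          by (auto simp: mX)
        have "V \<in> hungry_profiles n" using V(1) div' by (auto simp: divisible_def)
        note Vb = hungry_profilesD[OF this b]
        have "sp_tiling n V (insert b ({1..n} - {b})) 0 (X(b := {0..m'}))"
          using V Vb mc share[OF V(1)] cum_less_iff[OF Vb mc, of m']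
          by (intro sp_tiling_insert) (auto simp: cake_def)
        then show "connected_sp_allocation n V (X(b := {0..m'}))"
          using b by (intro connected_sp_allocation_sp_tiling) (simp add: insert_absorb)
      qed
    qed
    then show "solvable n ((n - 1) * (n + 2)) S' (connected_sp_allocation n)" by simp
  qed (use n in simp)
  then show ?thesis by simp
qed

text \<open>At the start everybody expects exactly \<open>n / n\<close>, so nobody has a surplus and
  the disagreement serves as the witness.\<close>

lemma divisible_if_marks_differ:
  assumes "S \<subseteq> hungry_profiles n" "i \<in> {1..n}" "j \<in> {1..n}" "y \<in> cake" "k \<in> {1..<n}"
    and "\<And>V. V \<in> S \<Longrightarrow> cum (V i) y = real k / real n"
    and "\<And>V. V \<in> S \<Longrightarrow> cum (V j) y \<noteq> real k / real n"
  shows "divisible n S {1..n} 0"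
  unfolding divisible_def
proof (intro conjI disjI2)
  have cum0: "cum (V i) 0 = 0" if "V \<in> S" "i \<in> {1..n}" for V i
    using that assms(1) hungry_profilesD[of V n i] cum_0 by blast
  show "\<forall>V\<in>S. \<forall>i\<in>{1..n}. real (card {1..n}) / real n \<le> 1 - cum (V i) 0"
    by (simp add: cum0)
  show "\<exists>i\<in>{1..n}. \<exists>j\<in>{1..n}. \<exists>y\<in>cake. \<exists>k. 0 < k \<and> k < card {1..n} \<and>
        (\<forall>V\<in>S. cum (V i) y - cum (V i) 0 = real k / real n \<and>
               cum (V j) y - cum (V j) 0 \<noteq> real k / real n)"
    using assms cum0
    by (intro bexI[of _ i] bexI[of _ j] bexI[of _ y] exI[of _ k]) auto
qed (use assms in \<open>auto simp: cake_def\<close>)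

text \<open>Existence is read off the algorithm, applied to the information set
  \<open>{V}\<close>.\<close>

lemma sp_allocation_if_marks_differ:
  assumes "V \<in> hungry_profiles n" "i \<in> {1..n}" "j \<in> {1..n}" "y \<in> cake" "k \<in> {1..<n}"
    and "cum (V i) y = real k / real n" "cum (V j) y \<noteq> real k / real n"
  shows "\<exists>X. connected_sp_allocation n V X"
proof -
  have "divisible n {V} {1..n} 0"
    using assms by (intro divisible_if_marks_differ[of _ _ i j y k]) auto
  then have "solvable n (n + (n - 1) * (n + 2)) {V} (connected_sp_allocation n)"
    using assms(5) by (intro solvable_sp_allocation) auto
  then show ?thesis by (auto simp: solvable_def)
qed

text \<open>All inner marks of all agents are asked first. Either they coincide and refute, or the
  answers exhibit a disagreement from which the allocation can be computed.\<close>

lemma solvable_sp_or_refute: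
  assumes n: "2 \<le> n"
  shows "solvable n (3 * n\<^sup>2) (hungry_profiles n) (\<lambda>V answer. case answer of
      Some X \<Rightarrow> connected_sp_allocation n V X
    | None \<Rightarrow> \<not> (\<exists>X. connected_sp_allocation n V X))"
    (is "solvable n _ ?H ?ok")
proof -
  define Q where "Q = {1..n} \<times> (\<lambda>k. real k / real n) ` {1..<n}"
  have "solvable n (card Q + (n + (n - 1) * (n + 2))) ?H ?ok"
  proof (rule solvable_marks[where x = 0])
    show "finite Q" "0 \<in> cake" by (auto simp: Q_def cake_def)
    show "i \<in> {1..n} \<and> 0 \<le> r" if "(i, r) \<in> Q" for i r using that by (auto simp: Q_def)
    fix \<mu> :: "nat \<Rightarrow> real \<Rightarrow> ereal"
    define S where "S = {V \<in> ?H. \<forall>(i, r)\<in>Q. mark_query (V i) 0 r = \<mu> i r}"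
    define m where "m i k = real_of_ereal (\<mu> i (real k / real n))" for i k
    have SH: "S \<subseteq> ?H" by (auto simp: S_def)
    have m: "m i k \<in> cake \<and> cum (V i) (m i k) = real k / real n"
      if V: "V \<in> S" and i: "i \<in> {1..n}" and k: "k \<in> {1..<n}" for V i k
    proof -
      note Vi = hungry_profilesD[OF subsetD[OF SH V] i]
      have mark: "mark_query (V i) 0 (real k / real n) = \<mu> i (real k / real n)"
        using V i k by (auto simp: S_def Q_def)
      have "cum (V i) 0 + real k / real n \<le> 1" using k cum_0[OF Vi(1)] by simp
      then obtain z where "mark_query (V i) 0 (real k / real n) = ereal z" "z \<in> cake"
          "cum (V i) z = cum (V i) 0 + real k / real n"
        using mark_query_finite[OF Vi \<open>0 \<in> cake\<close>, of "real k / real n"] by auto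
      then show ?thesis using mark cum_0[OF Vi(1)] by (simp add: m_def)
    qed
    have "solvable n (n + (n - 1) * (n + 2)) S ?ok"
    \<comment> \<open>Comparison with agent 1 suffices: if no agent deviates from the marks of agent
      1, all marks are common.\<close>
    proof (cases "\<forall>i\<in>{1..n}. \<forall>k\<in>{1..<n}. m i k = m 1 k")
      case True
      have "\<not> connected_sp_allocation n V X" if V: "V \<in> S" for V X
      proof (rule no_sp_allocation_if_common_marks[OF subsetD[OF SH V]])
        show "0 < n" using n by simp
        fix k i assume ki: "k \<in> {1..<n}" "i \<in> {1..n}"
        then have "m i k = m 1 k" using True by blast
        then show "m 1 k \<in> cake \<and> cum (V i) (m 1 k) = real k / real n"
          using m[OF V ki(2,1)] by (simp only:)
      qed
      then show ?thesis by (intro solvable_output[where out = None]) simp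
    next
      case False
      then obtain i k where ik: "i \<in> {1..n}" "k \<in> {1..<n}" "m i k \<noteq> m 1 k" by blast
      show ?thesis
      proof (rule solvable_nonempty)
        assume "S \<noteq> {}"
        then obtain V0 where V0: "V0 \<in> S" by blast
        have one: "1 \<in> {1..n}" using n by simp
        have "divisible n S {1..n} 0"
        proof (rule divisible_if_marks_differ[OF SH ik(1) one _ ik(2), of "m i k"])
          show "m i k \<in> cake" using m[OF V0 ik(1,2)] by blast
          fix V assume V: "V \<in> S"
          show "cum (V i) (m i k) = real k / real n" using m[OF V ik(1,2)] by blast
          show "cum (V 1) (m i k) \<noteq> real k / real n"
            using m[OF V ik(1,2)] m[OF V one ik(2)] ik(3)
              cum_eq_iff[OF hungry_profilesD[OF subsetD[OF SH V] one], of "m i k" "m 1 k"] by auto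
        qed
        from solvable_sp_allocation[OF this n]
        show "solvable n (n + (n - 1) * (n + 2)) S ?ok"
          by (rule solvable_map[where f = Some]) simp
      qed
    qed
    then show "solvable n (n + (n - 1) * (n + 2))
        {V \<in> ?H. \<forall>(i, r)\<in>Q. mark_query (V i) 0 r = \<mu> i r} ?ok"
      by (simp add: S_def)
  qed
  \<comment> \<open>At most \<open>n * n\<close> queries go into the marks and at most
    \<open>2 * (n * n)\<close> into the allocation.\<close>
  moreover have "card Q + (n + (n - 1) * (n + 2)) \<le> 3 * n\<^sup>2"
  proof -
    have "card ((\<lambda>k. real k / real n) ` {1..<n}) \<le> n"
      using card_image_le[of "{1..<n}" "\<lambda>k. real k / real n"] by simp
    then have "card Q \<le> n * n" by (simp add: Q_def card_cartesian_product)
    moreover have "n + (n - 1) * (n + 2) \<le> 2 * (n * n)"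
    proof -
      obtain k where "n = k + 2" using n by (metis add.commute le_Suc_ex)
      then show ?thesis by (simp add: algebra_simps)
    qed
    ultimately show ?thesis by (simp add: power2_eq_square)
  qed
  ultimately show ?thesis by (rule solvable_mono[OF _ subset_refl])
qed

section \<open>Perturbations of the uniform valuation\<close>

text \<open>For \<open>0 \<le> e\<close>, Lebesgue measure with density changed to
  \<open>1 + c\<close> on the left and \<open>1 - c\<close> on the right of \<open>b\<close>, up to
  distance \<open>e\<close>. The changes cancel, so only cumulative values strictly within distance
  \<open>e\<close> of \<open>b\<close> are affected.\<close>

definition bump :: "real \<Rightarrow> real \<Rightarrow> real \<Rightarrow> real set \<Rightarrow> real" where
  "bump c b e X = measure lborel X +
     c * (measure lborel (X \<inter> {b - e..b}) - measure lborel (X \<inter> {b..b + e}))"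

text \<open>Additivity and positivity of \<open>bump\<close> can thus be shown on Borel sets,
  without describing the generated algebra.\<close>

lemma cake_algebra_borel: "cake_algebra \<subseteq> {X. X \<subseteq> cake \<and> X \<in> sets borel}"
  unfolding cake_algebra_def
proof (rule hull_minimal)
  show "{I. is_interval I \<and> I \<subseteq> cake} \<subseteq> {X. X \<subseteq> cake \<and> X \<in> sets borel}"
    using real_interval_borel_measurable by blast
  show "algebra cake {X. X \<subseteq> cake \<and> X \<in> sets borel}"
    by (auto simp: algebra_iff_Un cake_def)
qed

lemma cake_fmeasurable: "X \<subseteq> cake \<Longrightarrow> X \<in> sets borel \<Longrightarrow> X \<in> fmeasurable lborel"
  by (rule fmeasurableI2[of "{0..1}"]) (auto simp: cake_def fmeasurable_def)

lemma bump_additive: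
  assumes "X \<in> fmeasurable lborel" "Y \<in> fmeasurable lborel" "X \<inter> Y = {}"
  shows "bump c b e (X \<union> Y) = bump c b e X + bump c b e Y"
proof -
  have "measure lborel ((X \<union> Y) \<inter> I) = measure lborel (X \<inter> I) + measure lborel (Y \<inter> I)"
    if "I \<in> sets borel" for I
  proof -
    have "X \<inter> I \<in> fmeasurable lborel" "Y \<inter> I \<in> fmeasurable lborel"
      using assms that by (auto intro!: fmeasurable.Int fmeasurable_Int_fmeasurable)
    moreover have "(X \<union> Y) \<inter> I = (X \<inter> I) \<union> (Y \<inter> I)" "(X \<inter> I) \<inter> (Y \<inter> I) = {}"
      using assms(3) by auto
    ultimately show ?thesis
      using measure_Union[of lborel "X \<inter> I" "Y \<inter> I"] by (simp add: fmeasurable_def less_top)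
  qed
  from this[of UNIV] this[of "{b - e..b}"] this[of "{b..b + e}"] show ?thesis
    by (simp add: bump_def algebra_simps)
qed

text \<open>The density never drops below \<open>1 - \<bar>c\<bar>\<close>. This yields
  non-negativity and, if \<open>\<bar>c\<bar> < 1\<close>, hunger.\<close>

lemma bump_ge:
  assumes X: "X \<in> fmeasurable lborel" and c: "\<bar>c\<bar> \<le> 1"
  shows "(1 - \<bar>c\<bar>) * measure lborel X \<le> bump c b e X"
proof -
  have "measure lborel (X \<inter> I) \<le> measure lborel X" if "I \<in> sets borel" for I
    using that fmeasurableD[OF X] by (intro measure_mono_fmeasurable X) auto
  then have "measure lborel (X \<inter> {b - e..b}) \<le> measure lborel X"
    "measure lborel (X \<inter> {b..b + e}) \<le> measure lborel X" by simp_all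
  then have "\<bar>measure lborel (X \<inter> {b - e..b}) - measure lborel (X \<inter> {b..b + e})\<bar> \<le> measure lborel X"
    using measure_nonneg[of lborel "X \<inter> {b - e..b}"] measure_nonneg[of lborel "X \<inter> {b..b + e}"]
    by linarith
  then have "\<bar>c * (measure lborel (X \<inter> {b - e..b}) - measure lborel (X \<inter> {b..b + e}))\<bar>
      \<le> \<bar>c\<bar> * measure lborel X"
    by (simp add: abs_mult mult_left_mono)
  then show ?thesis by (simp add: bump_def algebra_simps abs_le_iff)
qed

lemma cum_bump:
  assumes "0 \<le> e" "e \<le> b" "0 \<le> x"
  shows "cum (bump c b e) x = x + c * (max 0 (min x b - (b - e)) - max 0 (min x (b + e) - b))"
proof -
  have "{0..x} \<inter> {b - e..b} = {b - e..min x b}" "{0..x} \<inter> {b..b + e} = {b..min x (b + e)}"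
    using assms by auto
  then show ?thesis using assms by (auto simp: cum_def bump_def max_def)
qed

lemma cum_bump_outside:
  assumes "0 \<le> e" "e \<le> b" "0 \<le> x" "x \<notin> {b - e<..<b + e}"
  shows "cum (bump c b e) x = x"
  using assms by (subst cum_bump) (auto simp: max_def min_def)

lemma cum_bump_mid: "0 \<le> e \<Longrightarrow> e \<le> b \<Longrightarrow> cum (bump c b e) b = b + c * e"
  by (subst cum_bump) (auto simp: max_def min_def)

lemma hungry_valuation_bump:
  assumes c: "\<bar>c\<bar> < 1" and e: "0 \<le> e" "e \<le> b" "b + e \<le> 1"
  shows "valuation (bump c b e)" "hungry (bump c b e)"
proof -
  have ge: "(1 - \<bar>c\<bar>) * measure lborel X \<le> bump c b e X" if "X \<subseteq> cake" "X \<in> sets borel" for X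
    using that c by (intro bump_ge cake_fmeasurable) auto
  have "continuous_on cake (cum (bump c b e)) \<longleftrightarrow> continuous_on cake
      (\<lambda>x. x + c * (max 0 (min x b - (b - e)) - max 0 (min x (b + e) - b)))"
    using e by (intro continuous_on_cong) (auto simp: cum_bump cake_def)
  then have "continuous_on cake (cum (bump c b e))" by (auto intro!: continuous_intros)
  moreover have "bump c b e cake = 1"
    using cum_bump_outside[of e b 1 c] e by (simp add: cum_def cake_def)
  moreover have "bump c b e {0} = 0"
    using cum_bump_outside[of e b 0 c] e by (simp add: cum_def)
  moreover have "0 \<le> bump c b e X" if "X \<in> cake_algebra" for X
  proof -
    have "0 \<le> (1 - \<bar>c\<bar>) * measure lborel X" using c by simp
    then show ?thesis using ge[of X] that cake_algebra_borel by fastforce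
  qed
  moreover have "Measure_Space.additive cake_algebra (bump c b e)"
    unfolding Measure_Space.additive_def
    using cake_algebra_borel by (auto intro!: bump_additive cake_fmeasurable)
  ultimately show "valuation (bump c b e)"
    unfolding valuation_def cum_def[abs_def] by blast
  show "hungry (bump c b e)"
    unfolding hungry_def
  proof (intro allI impI)
    fix X assume X: "is_interval X \<and> X \<subseteq> cake \<and> 0 < measure lborel X"
    then have "0 < (1 - \<bar>c\<bar>) * measure lborel X" using c by simp
    then show "0 < bump c b e X"
      using ge[of X] X real_interval_borel_measurable by fastforce
  qed
qed

abbreviation uniform :: "nat \<Rightarrow> real set \<Rightarrow> real" where
  "uniform \<equiv> \<lambda>_. measure lborel"

lemma bump_0: "bump 0 b e = measure lborel"
  by (simp add: bump_def fun_eq_iff)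

lemma uniform_hungry: "uniform \<in> hungry_profiles n"
  using hungry_valuation_bump[of 0 0 0] by (simp add: hungry_profiles_def bump_0)

lemma cum_uniform: "0 \<le> x \<Longrightarrow> cum (uniform i) x = x"
  by (simp add: cum_def)

lemma no_sp_allocation_uniform: "0 < n \<Longrightarrow> \<not> connected_sp_allocation n uniform X"
  by (rule no_sp_allocation_if_common_marks[OF uniform_hungry, where m = "\<lambda>k. real k / real n"])
    (auto simp: cum_uniform cake_def)

section \<open>The adversary\<close>

text \<open>
  The points at which the first \<open>t\<close> queries of an algorithm run on the uniform profile reveal
  the value of some \<open>V i [0, p]\<close>.
\<close>

primrec touched :: "'o algorithm \<Rightarrow> nat \<Rightarrow> (nat \<times> real) set" where
  "touched (Output out) t = {}"
| "touched (Eval i x y k) t = (case t of 0 \<Rightarrow> {} | Suc t' \<Rightarrow>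
     {(i, x), (i, y)} \<union> touched (k (eval_query (uniform i) x y)) t')"
| "touched (Mark i x r k) t = (case t of 0 \<Rightarrow> {} | Suc t' \<Rightarrow>
     {(i, x), (i, x + r)} \<union> touched (k (mark_query (uniform i) x r)) t')"

lemma finite_touched: "finite (touched A t) \<and> card (touched A t) \<le> 2 * t"
proof -
  have step: "finite (insert p (insert q T)) \<and> card (insert p (insert q T)) \<le> 2 * Suc t"
    if "finite T \<and> card T \<le> 2 * t" for p q :: "nat \<times> real" and T t
    using that card_insert_le_m1[of "Suc (Suc (2 * t))" "insert q T" p]
      card_insert_le_m1[of "Suc (2 * t)" T q] by simp
  show ?thesis
  proof (induction A arbitrary: t)
    case (Output out)
    then show ?case by simp
  next
    case (Eval i x y k)
    show ?case using step[OF Eval.IH[OF rangeI]] by (cases t) simp_all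
  next
    case (Mark i x r k)
    show ?case using step[OF Mark.IH[OF rangeI]] by (cases t) simp_all
  qed
qed

text \<open>As long as the values at touched points are the uniform ones, each answer is too, and
  both runs follow the same branch of the tree.\<close>

lemma run_eq_uniform_run:
  assumes "V \<in> hungry_profiles n" "legal n A"
    and "\<And>i p. (i, p) \<in> touched A t \<Longrightarrow> p \<in> cake \<Longrightarrow> cum (V i) p = p"
    and "query_count V A < t"
  shows "run V A = run uniform A"
  using assms(2-)
proof (induction A arbitrary: t)
  case (Output out)
  then show ?case by simp
next
  case (Eval i x y k)
  then obtain t' where t: "t = Suc t'" by (cases t) auto
  from Eval.prems have legal: "i \<in> {1..n}" "0 \<le> x" "x \<le> y" "y \<le> 1" by (auto simp: cake_def)
  have "cum (V i) x = x" "cum (V i) y = y"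
    using legal Eval.prems(2)[of i] by (auto simp: t cake_def)
  then have eq: "eval_query (V i) x y = eval_query (uniform i) x y"
    using legal valuation_interval[OF hungry_profilesD(1)[OF assms(1) legal(1)], of x y]
    by (simp add: eval_query_def)
  show ?case
    using Eval.IH[OF rangeI, of "eval_query (uniform i) x y" t'] Eval.prems by (auto simp: t eq)
next
  case (Mark i x r k)
  then obtain t' where t: "t = Suc t'" by (cases t) auto
  from Mark.prems have legal: "i \<in> {1..n}" "x \<in> cake" "0 \<le> r" by auto
  \<comment> \<open>If \<open>x + r\<close> exceeds 1, the answer is infinite for every profile;
    hence agreement is needed only at touched points inside the cake.\<close>
  have answer: "mark_query (W i) x r = (if x + r \<le> 1 then ereal (x + r) else \<infinity>)"
    if W: "W \<in> hungry_profiles n" "\<And>p. p \<in> {x, x + r} \<Longrightarrow> p \<in> cake \<Longrightarrow> cum (W i) p = p" for W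
    using mark_query_eq[OF hungry_profilesD[OF W(1) legal(1)], of x "x + r" r]
      mark_query_infinity[OF hungry_profilesD(1)[OF W(1) legal(1)], of x r] W(2) legal
    by (auto simp: cake_def)
  have eq: "mark_query (V i) x r = mark_query (uniform i) x r"
  proof -
    have "cum (V i) p = p" if "p \<in> {x, x + r}" "p \<in> cake" for p
      using that Mark.prems(2)[of i p] by (auto simp: t)
    from answer[OF assms(1) this] show ?thesis
      using answer[OF uniform_hungry] by (simp add: cum_uniform cake_def)
  qed
  show ?case
    using Mark.IH[OF rangeI, of "mark_query (uniform i) x r" t'] Mark.prems by (auto simp: t eq)
qed

text \<open>There are \<open>n * (n - 1)\<close> pairs of an agent and an inner mark, but
  \<open>t\<close> queries touch at most \<open>2 * t\<close> points. Opposite bumps at an untouched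
  mark give \<open>V\<close> and \<open>W\<close>, whose average is the uniform profile.\<close>

lemma adversary:
  assumes legal: "legal n A" and t: "2 * t < n * (n - 1)"
  obtains V W where "V \<in> hungry_profiles n" "W \<in> hungry_profiles n"
    "\<exists>X. connected_sp_allocation n V X" "\<exists>X. connected_sp_allocation n W X"
    "\<And>i X. V i X + W i X = 2 * measure lborel X"
    "query_count V A < t \<Longrightarrow> run V A = run uniform A"
    "query_count W A < t \<Longrightarrow> run W A = run uniform A"
proof -
  have n: "2 \<le> n" using t by (cases n rule: nat.exhaust; cases "n - 1") auto
  define f where "f = (\<lambda>(i :: nat, k). (i, real k / real n))"
  have "inj_on f ({1..n} \<times> {1..<n})" using n by (auto simp: inj_on_def f_def)
  then have "card (f ` ({1..n} \<times> {1..<n})) = n * (n - 1)"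
    by (simp add: card_image card_cartesian_product)
  then have "\<not> f ` ({1..n} \<times> {1..<n}) \<subseteq> touched A t"
    using card_mono[of "touched A t" "f ` ({1..n} \<times> {1..<n})"] finite_touched[of A t] t by auto
  then obtain q where q: "q \<in> {1..n} \<times> {1..<n}" "f q \<notin> touched A t" by blast
  then obtain i k where i: "i \<in> {1..n}" and k: "k \<in> {1..<n}"
    and untouched: "(i, real k / real n) \<notin> touched A t"
    by (cases q) (auto simp: f_def)
  define b where "b = real k / real n"
  have b: "0 < b" "b < 1" using k by (auto simp: b_def)
  \<comment> \<open>Besides the touched points of agent \<open>i\<close>, the bump avoids 0 and 1
    and so stays inside the cake.\<close>
  define P where "P = insert 0 (insert 1 (snd ` (touched A t \<inter> {i} \<times> UNIV)))"
  have "finite P" using finite_touched[of A t] by (simp add: P_def)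
  moreover have "b \<notin> P" using untouched b by (force simp: P_def b_def[symmetric])
  ultimately obtain e where e: "0 < e" "\<And>p. p \<in> P \<Longrightarrow> e \<le> dist b p"
    using finite_set_avoid[of P b] by (metis)
  have e01: "e \<le> b" "b + e \<le> 1"
    using e(2)[of 0] e(2)[of 1] b by (auto simp: P_def dist_real_def)
  define B where "B c = uniform(i := bump c b e)" for c
  have B: "B c \<in> hungry_profiles n" if "\<bar>c\<bar> < 1" for c
    using hungry_valuation_bump[OF that, of e b] e(1) e01 uniform_hungry[of n]
    by (auto simp: B_def hungry_profiles_def)
  \<comment> \<open>The bump moves the mark of \<open>i\<close> away from \<open>b\<close>, where
    every other agent \<open>j\<close> still has it.\<close>
  have alloc: "\<exists>X. connected_sp_allocation n (B c) X" if c: "\<bar>c\<bar> < 1" "c \<noteq> 0" for c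
  proof -
    obtain j where j: "j \<in> {1..n}" "j \<noteq> i"
    proof -
      have "(if i = 1 then 2 else 1) \<in> {1..n}" "(if i = 1 then 2 else 1) \<noteq> i" using n by auto
      then show thesis by (rule that)
    qed
    show ?thesis
    proof (rule sp_allocation_if_marks_differ[OF B[OF c(1)] j(1) i _ k, of b])
      show "b \<in> cake" using b by (simp add: cake_def)
      show "cum (B c j) b = real k / real n" using j b by (simp add: B_def cum_uniform b_def)
      show "cum (B c i) b \<noteq> real k / real n"
        using cum_bump_mid[of e b c] c(2) e(1) e01 by (simp add: B_def b_def)
    qed
  qed
  have run: "run (B c) A = run uniform A" if c: "\<bar>c\<bar> < 1" "query_count (B c) A < t" for c
  proof (rule run_eq_uniform_run[OF B[OF c(1)] legal _ c(2)])
    fix j p assume jp: "(j, p) \<in> touched A t" "p \<in> cake"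
    show "cum (B c j) p = p"
    proof (cases "j = i")
      case True
      then have "p \<in> P" using jp by (force simp: P_def)
      then have "p \<notin> {b - e<..<b + e}" using e(2)[of p] by (auto simp: dist_real_def)
      then show ?thesis using cum_bump_outside[of e b p c] e(1) e01 jp True
        by (simp add: B_def cake_def)
    next
      case False
      then show ?thesis using jp by (simp add: B_def cum_uniform cake_def)
    qed
  qed
  \<comment> \<open>Opposite signs cancel; any \<open>c\<close> strictly between 0 and 1 could
    replace \<open>1/2\<close>.\<close>
  have "B (1/2) j X + B (- 1/2) j X = 2 * measure lborel X" for j X
    by (simp add: B_def bump_def)
  then show thesis
    by (intro that[of "B (1/2)" "B (- 1/2)"] B alloc run) auto
qed

section \<open>Lower bounds for the three tasks\<close>

text \<open>The correct answers for the uniform profile and for \<open>V\<close> differ, so fewer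
  than \<open>t\<close> queries on \<open>V\<close> cannot suffice.\<close>

lemma decision_lower_bound:
  assumes t: "2 * t < n * (n - 1)"
  shows "enat t \<le> query_complexity n (hungry_profiles n)
    (\<lambda>V answer. answer \<longleftrightarrow> (\<exists>X. connected_sp_allocation n V X))"
proof (rule query_complexity_ge)
  fix A :: "bool algorithm"
  assume A: "legal n A" "solves (hungry_profiles n)
    (\<lambda>V answer. answer \<longleftrightarrow> (\<exists>X. connected_sp_allocation n V X)) A"
  obtain V W where V: "V \<in> hungry_profiles n" "\<exists>X. connected_sp_allocation n V X"
    "query_count V A < t \<Longrightarrow> run V A = run uniform A"
    by (rule adversary[OF A(1) t]) blast
  have "0 < n" using t by (cases n) auto
  then have "\<not> run uniform A"
    using A(2) uniform_hungry no_sp_allocation_uniform by (auto simp: solves_def)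
  moreover have "run V A" using A(2) V(1,2) by (auto simp: solves_def)
  ultimately show "\<exists>V\<in>hungry_profiles n. t \<le> query_count V A"
    using V(1,3) by (intro bexI[of _ V]) (auto simp: not_less[symmetric])
qed

text \<open>The uniform profile is not an admissible input here, so it cannot be compared with
  \<open>V\<close> directly. Instead, few queries force the same output on \<open>V\<close> and
  \<open>W\<close>; averaging the two makes it strongly-proportional for the uniform profile, which
  is impossible.\<close>

lemma computation_lower_bound:
  assumes t: "2 * t < n * (n - 1)"
  shows "enat t \<le> query_complexity n
    {V \<in> hungry_profiles n. \<exists>X. connected_sp_allocation n V X} (connected_sp_allocation n)"
    (is "_ \<le> query_complexity n ?S _")
proof (rule query_complexity_ge)
  fix A assume A: "legal n A" "solves ?S (connected_sp_allocation n) A"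
  obtain V W where VW: "V \<in> ?S" "W \<in> ?S" "\<And>i X. V i X + W i X = 2 * measure lborel X"
    "query_count V A < t \<Longrightarrow> run V A = run uniform A"
    "query_count W A < t \<Longrightarrow> run W A = run uniform A"
    by (rule adversary[OF A(1) t]) blast
  have n: "0 < n" using t by (cases n) auto
  show "\<exists>V\<in>?S. t \<le> query_count V A"
  proof (rule ccontr)
    assume "\<not> ?thesis"
    then have "query_count V A < t" "query_count W A < t" using VW(1,2) by (meson not_less)+
    then have "run V A = run uniform A" "run W A = run uniform A" using VW(4,5) by blast+
    moreover have "connected_sp_allocation n V (run V A)" "connected_sp_allocation n W (run W A)"
      using A(2) VW(1,2) unfolding solves_def by blast+
    ultimately have "connected_allocation n (run uniform A)"
      and gt: "\<And>i. i \<in> {1..n} \<Longrightarrow> V i (run uniform A i) > 1 / real n \<and> W i (run uniform A i) > 1 / real n"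
      by (auto simp: connected_sp_allocation_def strongly_proportional_def equal_entitlements_def)
    moreover have "measure lborel (run uniform A i) > 1 / real n" if "i \<in> {1..n}" for i
      using gt[OF that] VW(3)[of i "run uniform A i"] by linarith
    ultimately have "connected_sp_allocation n uniform (run uniform A)"
      by (simp add: connected_sp_allocation_def strongly_proportional_def equal_entitlements_def)
    then show False using no_sp_allocation_uniform[OF n] by blast
  qed
qed

text \<open>The output must be \<open>None\<close> on the uniform profile but not on
  \<open>V\<close>.\<close>

lemma refutation_lower_bound:
  assumes t: "2 * t < n * (n - 1)"
  shows "enat t \<le> query_complexity n (hungry_profiles n) (\<lambda>V answer. case answer of
      Some X \<Rightarrow> connected_sp_allocation n V X
    | None \<Rightarrow> \<not> (\<exists>X. connected_sp_allocation n V X))"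
    (is "_ \<le> query_complexity n _ ?ok")
proof (rule query_complexity_ge)
  fix A assume A: "legal n A" "solves (hungry_profiles n) ?ok A"
  obtain V W where V: "V \<in> hungry_profiles n" "\<exists>X. connected_sp_allocation n V X"
    "query_count V A < t \<Longrightarrow> run V A = run uniform A"
    by (rule adversary[OF A(1) t]) blast
  have "0 < n" using t by (cases n) auto
  moreover have "?ok uniform (run uniform A)" "?ok V (run V A)"
    using A(2) V(1) uniform_hungry unfolding solves_def by blast+
  ultimately have "run uniform A = None" "run V A \<noteq> None"
    using no_sp_allocation_uniform V(2) by (auto split: option.splits)
  then show "\<exists>V\<in>hungry_profiles n. t \<le> query_count V A"
    using V(1,3) by (intro bexI[of _ V]) (auto simp: not_less[symmetric])
qed

section \<open>Quadratic growth\<close>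

lemma queries_required_quadratic:
  assumes lower: "\<And>n t. 2 * t < n * (n - 1) \<Longrightarrow> enat t \<le> query_complexity n (S n) (ok n)"
    and upper: "\<And>n. 2 \<le> n \<Longrightarrow> solvable n (3 * n\<^sup>2) (S n) (ok n)"
  shows "(\<lambda>n. queries_required n (S n) (ok n)) \<in> \<Theta>(\<lambda>n. (real n)\<^sup>2)"
proof (rule bigthetaI'[of "1/16" 3])
  have "1/16 * (real n)\<^sup>2 \<le> queries_required n (S n) (ok n) \<and>
      queries_required n (S n) (ok n) \<le> 3 * (real n)\<^sup>2" if n: "4 \<le> n" for n
  proof -
    \<comment> \<open>With divisor 8, \<open>2 * t\<close> is at most a quarter of
      \<open>n * n\<close>, which is below \<open>n * (n - 1)\<close> for \<open>n \<ge> 4\<close>.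
      Rounding down loses at most a factor 2 there, whence the constant \<open>1/16\<close>.\<close>
    define t where "t = n\<^sup>2 div 8"
    have sq: "4 * n \<le> n * n" using n by (rule mult_right_mono) simp
    have "2 * t < n * (n - 1)"
    proof -
      have "8 * t \<le> n * n" by (simp add: t_def power2_eq_square)
      moreover have "n * (n - 1) + n = n * n" using n by (cases n) auto
      ultimately show ?thesis using sq n by linarith
    qed
    moreover have "1/16 * (real n)\<^sup>2 \<le> real t"
    proof -
      have "n * n < 8 * t + 8" by (simp add: t_def power2_eq_square)
      moreover have "16 \<le> n * n" using sq n by linarith
      ultimately have "n * n \<le> 16 * t" by (simp add: t_def power2_eq_square)
      then have "real (n * n) \<le> real (16 * t)" by (rule of_nat_mono)
      then show ?thesis by (simp add: power2_eq_square)
    qed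
    moreover have "query_complexity n (S n) (ok n) \<le> enat (3 * n\<^sup>2)"
      using n by (intro query_complexity_le upper) simp
    ultimately show ?thesis
      using queries_required_bounds[OF lower[of t n], of "3 * n\<^sup>2"] by simp
  qed
  then show "eventually (\<lambda>n. 1/16 * norm ((real n)\<^sup>2) \<le> norm (queries_required n (S n) (ok n)) \<and>
      norm (queries_required n (S n) (ok n)) \<le> 3 * norm ((real n)\<^sup>2)) at_top"
    by (intro eventually_at_top_linorderI[of 4]) fastforce
qed auto

theorem theorem4:
  shows "decision_queries \<in> \<Theta>(\<lambda>n. (real n)\<^sup>2) \<and>
         computation_queries \<in> \<Theta>(\<lambda>n. (real n)\<^sup>2) \<and>
         computation_or_refutation_queries \<in> \<Theta>(\<lambda>n. (real n)\<^sup>2)"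
proof (intro conjI)
  \<comment> \<open>One algorithm gives all three upper bounds: its answer is only tested against
    \<open>None\<close> for the decision, and stripped by \<open>the\<close> when an allocation is
    known to exist.\<close>
  show "decision_queries \<in> \<Theta>(\<lambda>n. (real n)\<^sup>2)"
    unfolding decision_queries_def[abs_def]
    by (intro queries_required_quadratic decision_lower_bound
        solvable_map[OF solvable_sp_or_refute, where f = "\<lambda>answer. answer \<noteq> None"])
      (auto split: option.splits)
  show "computation_queries \<in> \<Theta>(\<lambda>n. (real n)\<^sup>2)"
    unfolding computation_queries_def[abs_def]
    by (intro queries_required_quadratic computation_lower_bound
        solvable_map[OF solvable_mono[OF solvable_sp_or_refute], where f = the])
      (auto split: option.splits)
  show "computation_or_refutation_queries \<in> \<Theta>(\<lambda>n. (real n)\<^sup>2)"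
    unfolding computation_or_refutation_queries_def[abs_def]
    by (intro queries_required_quadratic refutation_lower_bound solvable_sp_or_refute)
qed

end
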